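(* Let $(\mathcal{E},\cdot)$ be a Leibniz algebra over a field $\mathbb{K}$ of characteristic $0$. Then $(\mathcal{E},[\![\cdot,\cdot]\!],\{\cdot,\cdot,\cdot\})$ is a Lie-Yamaguti algebra, where $[\![x,y]\!]=\tfrac12(x\cdot y-y\cdot x)$ and $\{\cdot,\cdot,\cdot\}$ is defined by either of the equivalent formulas $$\{x,y,z\}=-\tfrac14[\![x,y]\!]\cdot z=-\tfrac14(x\cdot y)\cdot z$$ for $x,y,z\in\mathcal{E}$.
   Context: An algebra $(\mathcal{E},\cdot)$ is a $\mathbb{K}$-vector space with a (not necessarily associative) bilinear operation. It is a (left) Leibniz algebra if $x\cdot(y\cdot z)=(x\cdot y)\cdot z+y\cdot(x\cdot z)$ for all $x,y,z\in\mathcal{E}$. A Lie-Yamaguti algebra $(\mathfrak{m},[\![\cdot,\cdot]\!],\{\cdot,\cdot,\cdot\})$ is a vector space $\mathfrak{m}$ with a bilinear operation $[\![\cdot,\cdot]\!]:\mathfrak{m}\times\mathfrak{m}\to\mathfrak{m}$ and a trilinear operation $\{\cdot,\cdot,\cdot\}:\mathfrak{m}\times\mathfrak{m}\times\mathfrak{m}\to\mathfrak{m}$ such that for all $x,y,z,u,v,w\in\mathfrak{m}$ (with $\sum_{(x,y,z)}$ denoting the sum over cyclic permutations of $x,y,z$): (LY1) $[\![x,y]\!]=-[\![y,x]\!]$; (LY2) $\{x,y,z\}=-\{y,x,z\}$; (LY3) $\sum_{(x,y,z)}\left([\![[\![x,y]\!],z]\!]+\{x,y,z\}\right)=0$; (LY4)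 $\sum_{(x,y,z)}\{[\![x,y]\!],z,u\}=0$; (LY5) $\{x,y,[\![u,v]\!]\}=[\![\{x,y,u\},v]\!]+[\![u,\{x,y,v\}]\!]$; (LY6) $\{x,y,\{u,v,w\}\}=\{\{x,y,u\},v,w\}+\{u,\{x,y,v\},w\}+\{u,v,\{x,y,w\}\}$. *)

theory Defs
  imports Complex_Main
begin

locale nonassoc_algebra = vector_space scale
  for scale :: "'k::field \<Rightarrow> 'a::ab_group_add \<Rightarrow> 'a" +
  fixes mult :: "'a \<Rightarrow> 'a \<Rightarrow> 'a"  (infixl \<open>\<cdot>\<close> 70)
  assumes mult_linear_left: "\<And>y. Vector_Spaces.linear scale scale (\<lambda>x. x \<cdot> y)"
    and mult_linear_right: "\<And>x. Vector_Spaces.linear scale scale (\<lambda>y. x \<cdot> y)"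

text \<open>Left Leibniz algebras: every left multiplication is a derivation.\<close>

locale leibniz_algebra = nonassoc_algebra scale mult
  for scale :: "'k::field \<Rightarrow> 'a::ab_group_add \<Rightarrow> 'a"
    and mult :: "'a \<Rightarrow> 'a \<Rightarrow> 'a"  (infixl \<open>\<cdot>\<close> 70) +
  assumes leibniz: "\<And>x y z. x \<cdot> (y \<cdot> z) = (x \<cdot> y) \<cdot> z + y \<cdot> (x \<cdot> z)"

locale lie_yamaguti_algebra = vector_space scale
  for scale :: "'k::field \<Rightarrow> 'a::ab_group_add \<Rightarrow> 'a" +
  fixes br :: "'a \<Rightarrow> 'a \<Rightarrow> 'a"
    and tri :: "'a \<Rightarrow> 'a \<Rightarrow> 'a \<Rightarrow> 'a"
  assumes br_linear_1: "\<And>y. Vector_Spaces.linear scale scale (\<lambda>x. br x y)"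
    and br_linear_2: "\<And>x. Vector_Spaces.linear scale scale (\<lambda>y. br x y)"
    and tri_linear_1: "\<And>y z. Vector_Spaces.linear scale scale (\<lambda>x. tri x y z)"
    and tri_linear_2: "\<And>x z. Vector_Spaces.linear scale scale (\<lambda>y. tri x y z)"
    and tri_linear_3: "\<And>x y. Vector_Spaces.linear scale scale (\<lambda>z. tri x y z)"
    and LY1: "\<And>x y. br x y = - br y x"
    and LY2: "\<And>x y z. tri x y z = - tri y x z"
    and LY3: "\<And>x y z. (br (br x y) z + tri x y z)
                     + (br (br y z) x + tri y z x)
                     + (br (br z x) y + tri z x y) = 0"
    and LY4: "\<And>x y z u. tri (br x y) z u + tri (br y z) x u + tri (br z x) y u = 0"
    and LY5: "\<And>x y u v. tri x y (br u v) = br (tri x y u) v + br u (tri x y v)"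
    and LY6: "\<And>x y u v w. tri x y (tri u v w)
                     = tri (tri x y u) v w + tri u (tri x y v) w + tri u v (tri x y w)"

definition skew_bracket ::
  "('k::field \<Rightarrow> 'a::ab_group_add \<Rightarrow> 'a) \<Rightarrow> ('a \<Rightarrow> 'a \<Rightarrow> 'a) \<Rightarrow> 'a \<Rightarrow> 'a \<Rightarrow> 'a"
  where "skew_bracket scale mult x y = scale (1 / 2) (mult x y - mult y x)"

end

theory Submission
  imports Defs
begin

text \<open>
  Everything rests on what the Leibniz identity says about the left multiplications
  \<open>L\<^sub>x = (\<lambda>z. x \<cdot> z)\<close>. Read as \<open>L\<^bsub>x \<cdot> y\<^esub> = [L\<^sub>x, L\<^sub>y]\<close>, it shows that \<open>x \<mapsto> L\<^sub>x\<close> sends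
  the product to the commutator of operators, although the product itself need not be skew. Hence
  \<open>L\<^bsub>x \<cdot> y\<^esub>\<close> is skew in \<open>x, y\<close> (\<open>mult_mult_skew\<close>), which makes the two formulas for the ternary
  operation agree and gives (LY2), and the Jacobi identity for operators gives (LY4)
  (\<open>mult_cyclic_zero\<close>).

  Read as \<open>L\<^sub>x (y \<cdot> z) = L\<^sub>x y \<cdot> z + y \<cdot> L\<^sub>x z\<close>, it shows that each \<open>L\<^sub>x\<close> is a derivation of
  the product. A derivation of the product is a derivation of any operation composed from the
  product by linear combinations, in particular of the skew bracket and of the ternary operation.
  Since \<open>{x, y, _}\<close> is a scalar multiple of \<open>L\<^bsub>x \<cdot> y\<^esub>\<close>, this is (LY5) and (LY6).

  Only (LY3) ties the factor of the ternary operation to that of the bracket. With the factors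
  \<open>1 / 2\<close> and \<open>- 1 / 4\<close>, the term \<open>[[x, y], z] + {x, y, z}\<close> becomes a quarter of a sum of
  nested products whose contributions cancel under cyclic permutation (\<open>jacobiator_summand\<close>).
\<close>

lemma linear_simps:
  assumes "Vector_Spaces.linear s t f"
  shows "f (x + y) = f x + f y" "f (x - y) = f x - f y" "f (- x) = - f x" "f (s c x) = t c (f x)"
proof -
  interpret Vector_Spaces.linear s t f
    by fact
  show "f (x + y) = f x + f y" "f (x - y) = f x - f y" "f (- x) = - f x" "f (s c x) = t c (f x)"
    by (rule add diff neg scale)+
qed

context nonassoc_algebra
begin

abbreviation skew :: "'a \<Rightarrow> 'a \<Rightarrow> 'a"
  where "skew \<equiv> skew_bracket scale mult"

abbreviation triple :: "'a \<Rightarrow> 'a \<Rightarrow> 'a \<Rightarrow> 'a"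
  where "triple x y z \<equiv> scale (- (1 / 4)) ((x \<cdot> y) \<cdot> z)"

lemmas multilinear_simps =
  linear_simps [OF mult_linear_left] linear_simps [OF mult_linear_right]

lemmas scale_distribs =
  scale_right_distrib scale_right_diff_distrib

text \<open>
  Linearity is part of the notion because the bracket and the ternary operation carry scalar
  coefficients, which a map satisfying only the product rule need not respect.
\<close>

definition derivation :: "('a \<Rightarrow> 'a) \<Rightarrow> bool"
  where "derivation D \<longleftrightarrow> Vector_Spaces.linear scale scale D
    \<and> (\<forall>x y. D (x \<cdot> y) = D x \<cdot> y + x \<cdot> D y)"

lemma derivation_mult: "derivation D \<Longrightarrow> D (x \<cdot> y) = D x \<cdot> y + x \<cdot> D y"
  by (simp add: derivation_def)

lemma derivation_linear: "derivation D \<Longrightarrow> Vector_Spaces.linear scale scale D"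
  by (simp add: derivation_def)

lemma linear_scaled:
  assumes "Vector_Spaces.linear scale scale f"
  shows "Vector_Spaces.linear scale scale (\<lambda>x. scale c (f x))"
  using assms
  by (simp add: Vector_Spaces.linear_iff vector_space_axioms
      scale_right_distrib scale_left_commute)

lemma derivation_scaled:
  assumes "derivation D"
  shows "derivation (\<lambda>x. scale c (D x))"
  using assms
  by (simp add: derivation_def linear_scaled multilinear_simps scale_distribs)

lemma derivation_skew:
  assumes "derivation D"
  shows "D (skew u v) = skew (D u) v + skew u (D v)"
  by (simp add: skew_bracket_def linear_simps [OF derivation_linear [OF assms]]
      derivation_mult [OF assms] algebra_simps)

lemma derivation_triple:
  assumes "derivation D"
  shows "D (triple u v w) = triple (D u) v w + triple u (D v) w + triple u v (D w)"
proof -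
  have "D ((u \<cdot> v) \<cdot> w) = (D u \<cdot> v) \<cdot> w + (u \<cdot> D v) \<cdot> w + (u \<cdot> v) \<cdot> D w"
    by (simp only: derivation_mult [OF assms] multilinear_simps)
  then show ?thesis
    by (simp only: linear_simps [OF derivation_linear [OF assms]] scale_right_distrib)
qed

lemma linear_skew_left: "Vector_Spaces.linear scale scale (\<lambda>x. skew x y)"
  by (simp add: Vector_Spaces.linear_iff vector_space_axioms skew_bracket_def multilinear_simps
      scale_distribs scale_left_commute)

lemma skew_commute: "skew x y = - skew y x"
  by (simp add: skew_bracket_def scale_right_diff_distrib)

lemma linear_skew_right: "Vector_Spaces.linear scale scale (\<lambda>y. skew x y)"
  by (simp add: Vector_Spaces.linear_iff vector_space_axioms skew_bracket_def multilinear_simps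
      scale_distribs scale_left_commute)

lemma linear_mult_mult_left: "Vector_Spaces.linear scale scale (\<lambda>x. (x \<cdot> y) \<cdot> z)"
  by (simp add: Vector_Spaces.linear_iff vector_space_axioms multilinear_simps)

lemma linear_mult_mult_mid: "Vector_Spaces.linear scale scale (\<lambda>y. (x \<cdot> y) \<cdot> z)"
  by (simp add: Vector_Spaces.linear_iff vector_space_axioms multilinear_simps)

end

context leibniz_algebra
begin

lemma mult_mult_eq_commutator: "(x \<cdot> y) \<cdot> z = x \<cdot> (y \<cdot> z) - y \<cdot> (x \<cdot> z)"
  by (simp add: leibniz [of x y z])

lemma mult_mult_skew: "(y \<cdot> x) \<cdot> z = - ((x \<cdot> y) \<cdot> z)"
  by (simp add: mult_mult_eq_commutator)

text \<open>
  By the commutator formula the left-hand side is the cyclic sum of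
  \<open>[[L\<^sub>x, L\<^sub>y], L\<^sub>z] u\<close>, so this is the Jacobi identity for operators under composition.
\<close>

lemma mult_cyclic_zero:
  "((x \<cdot> y) \<cdot> z) \<cdot> u + ((y \<cdot> z) \<cdot> x) \<cdot> u + ((z \<cdot> x) \<cdot> y) \<cdot> u = 0"
  by (simp add: mult_mult_eq_commutator multilinear_simps)

lemma derivation_left_mult: "derivation (\<lambda>z. x \<cdot> z)"
  unfolding derivation_def by (intro conjI allI mult_linear_right leibniz)

end

text \<open>
  In characteristic 2 the term \<open>1 / 2\<close> denotes \<open>0\<close> and the bracket vanishes. The results
  below use that \<open>1 / 2 + 1 / 2 = 1\<close>.
\<close>

locale leibniz_algebra_char_0 = leibniz_algebra scale mult
  for scale :: "'k::field_char_0 \<Rightarrow> 'a::ab_group_add \<Rightarrow> 'a"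
    and mult :: "'a \<Rightarrow> 'a \<Rightarrow> 'a"  (infixl \<open>\<cdot>\<close> 70)
begin

lemma scale_half_double: "scale (1 / 2) (a + a) = a"
  by (simp add: scale_right_distrib flip: scale_left_distrib)

text \<open>Left multiplication by \<open>x \<cdot> y\<close> is skew in \<open>x, y\<close>, so the two halves of the bracket act equally.\<close>

lemma skew_mult: "skew x y \<cdot> z = (x \<cdot> y) \<cdot> z"
  by (simp add: skew_bracket_def multilinear_simps mult_mult_skew [of y x] scale_half_double)

text \<open>
  Under cyclic permutation of \<open>x, y, z\<close> the term \<open>x \<cdot> (y \<cdot> z)\<close> runs through the same three
  values as \<open>z \<cdot> (x \<cdot> y)\<close>, and \<open>y \<cdot> (x \<cdot> z)\<close> through the same as \<open>z \<cdot> (y \<cdot> x)\<close>. Both brackets on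
  the right therefore have cyclic sum zero.
\<close>

lemma jacobiator_summand:
  "skew (skew x y) z + triple x y z
    = scale (1 / 4) ((x \<cdot> (y \<cdot> z) - z \<cdot> (x \<cdot> y)) - (y \<cdot> (x \<cdot> z) - z \<cdot> (y \<cdot> x)))"
proof -
  have "skew (skew x y) z
      = scale (1 / 4) ((x \<cdot> y) \<cdot> z - (y \<cdot> x) \<cdot> z - z \<cdot> (x \<cdot> y) + z \<cdot> (y \<cdot> x))"
    by (simp add: skew_bracket_def multilinear_simps scale_distribs)
  also have "\<dots> + triple x y z
      = scale (1 / 4) ((x \<cdot> y) \<cdot> z - z \<cdot> (x \<cdot> y) + z \<cdot> (y \<cdot> x))"
    by (simp add: mult_mult_skew [of y x] scale_distribs)
  finally show ?thesis
    by (simp add: mult_mult_eq_commutator algebra_simps)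
qed

lemma lie_yamaguti: "lie_yamaguti_algebra scale skew triple"
proof (intro lie_yamaguti_algebra.intro lie_yamaguti_algebra_axioms.intro)
  fix x y z u v w
  show "vector_space scale"
    by (rule vector_space_axioms)
  show "Vector_Spaces.linear scale scale (\<lambda>x. skew x y)"
    by (rule linear_skew_left)
  show "Vector_Spaces.linear scale scale (\<lambda>y. skew x y)"
    by (rule linear_skew_right)
  show "Vector_Spaces.linear scale scale (\<lambda>x. triple x y z)"
    by (intro linear_scaled linear_mult_mult_left)
  show "Vector_Spaces.linear scale scale (\<lambda>y. triple x y z)"
    by (intro linear_scaled linear_mult_mult_mid)
  show "Vector_Spaces.linear scale scale (\<lambda>z. triple x y z)"
    by (intro linear_scaled mult_linear_right)
  show "skew x y = - skew y x"
    by (rule skew_commute)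
  show "triple x y z = - triple y x z"
    by (simp add: mult_mult_skew [of y x])
  show "(skew (skew x y) z + triple x y z) + (skew (skew y z) x + triple y z x)
      + (skew (skew z x) y + triple z x y) = 0"
    unfolding jacobiator_summand by (simp flip: scale_right_distrib)
  show "triple (skew x y) z u + triple (skew y z) x u + triple (skew z x) y u = 0"
    unfolding skew_mult
    by (simp only: mult_cyclic_zero scale_zero_right flip: scale_right_distrib)
  \<comment> \<open>This map is \<open>- 1 / 4\<close> times left multiplication by \<open>x \<cdot> y\<close>.\<close>
  have D: "derivation (\<lambda>z. triple x y z)"
    by (intro derivation_scaled derivation_left_mult)
  show "triple x y (skew u v) = skew (triple x y u) v + skew u (triple x y v)"
    by (rule derivation_skew [OF D])
  show "triple x y (triple u v w) = triple (triple x y u) v w + triple u (triple x y v) w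
      + triple u v (triple x y w)"
    by (rule derivation_triple [OF D])
qed

end

theorem proposition5p2:
  fixes scale :: "'k::field_char_0 \<Rightarrow> 'a::ab_group_add \<Rightarrow> 'a"
    and mult :: "'a \<Rightarrow> 'a \<Rightarrow> 'a"
  assumes "leibniz_algebra scale mult"
  shows "(\<forall>x y z. scale (- (1 / 4)) (mult (skew_bracket scale mult x y) z)
                = scale (- (1 / 4)) (mult (mult x y) z))
       \<and> lie_yamaguti_algebra scale (skew_bracket scale mult)
            (\<lambda>x y z. scale (- (1 / 4)) (mult (skew_bracket scale mult x y) z))
       \<and> lie_yamaguti_algebra scale (skew_bracket scale mult)
            (\<lambda>x y z. scale (- (1 / 4)) (mult (mult x y) z))"
proof -
  interpret leibniz_algebra_char_0 scale mult
    using assms by (simp add: leibniz_algebra_char_0_def)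
  show ?thesis
    unfolding skew_mult by (intro conjI allI refl lie_yamaguti)
qed

end
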